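(* Let $\mathcal{Q}$ be the value function defined in the context and let the following hold: (H1) $f:\mathbb{R}^n\times\mathbb{R}^m\to\mathbb{R}\cup\{+\infty\}$ is lower semicontinuous, proper and convex; (H2) each component $g_i:\mathbb{R}^n\times\mathbb{R}^m\to\mathbb{R}\cup\{+\infty\}$, $i=1,\ldots,p$, of $g$ is convex and lower semicontinuous; (H3) $f$ is differentiable on $Y\times X$ and there is $M_1>0$ such that $\|\nabla_yf(y_2,x)-\nabla_yf(y_1,x)\|\le M_1\|y_2-y_1\|$ for all $x\in X,y_1,y_2\in Y$; (H4) for every $x\in X$ there exists $y_x\in\mathrm{ri}(Y)$ such that $Bx+Ay_x=b$ and $g(y_x,x)<0$; (H5) $g$ is differentiable on $Y\times X$ and there is $M_2>0$ such that $\|\nabla_yg_i(y_2,x)-\nabla_yg_i(y_1,x)\|\le M_2\|y_2-y_1\|$ for all $i=1,\ldots,p$, $x\in X$, $y_1,y_2\in Y$. Let $\bar x\in X$, $\varepsilon\ge0$, let $\hat y(\varepsilon)$ be an $\varepsilon$-optimal feasible solution of the primal problem defining $\mathcal{Q}(\bar x)$, let $(\hat\lambda(\varepsilon),\hat\mu(\varepsilon))$ be an $\varepsilon$-optimal feasible solution of the dual problem $\sup_{(\lambda,\mu)\in\mathbb{R}^q\times\mathbb{R}_+^p}\theta_{\bar x}(\lambda,\mu)$, and let $\mathcal{L}_{\bar x}$ be any lower bound on $\mathcal{Q}(\bar x)$. Write $\ell_2=\ell_2(\hat y(\varepsilon),\bar x,\hat\lambda(\varepsilon),\hat\mu(\varepsilon))$.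 Then $$\mathcal{C}(x):=L_{\bar x}(\hat y(\varepsilon),\hat\lambda(\varepsilon),\hat\mu(\varepsilon))-\ell_2+\langle\nabla_xL_{\bar x}(\hat y(\varepsilon),\hat\lambda(\varepsilon),\hat\mu(\varepsilon)),x-\bar x\rangle$$ is a cut for $\mathcal{Q}$ at $\bar x$, and setting $M_3=M_1+\mathcal{U}_{\bar x}M_2$ with $$\mathcal{U}_{\bar x}=\frac{f(y_{\bar x},\bar x)-\mathcal{L}_{\bar x}+\varepsilon}{\min(-g_i(y_{\bar x},\bar x),\ i=1,\ldots,p)},$$ the distance $\mathcal{Q}(\bar x)-\mathcal{C}(\bar x)$ is at most $$\varepsilon_0=\begin{cases}\varepsilon+\ell_2-\dfrac{\ell_2^2}{2M_3\mathrm{Diam}(Y)^2}&\text{if }\ell_2\le M_3\mathrm{Diam}(Y)^2,\\[2mm]\varepsilon+\frac12\ell_2&\text{otherwise.}\end{cases}$$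
   Context: $X\subseteq\mathbb{R}^m$ and $Y\subseteq\mathbb{R}^n$ are nonempty, compact, convex; $A$ and $B$ are real $q\times n$ and $q\times m$ matrices, $b\in\mathbb{R}^q$; $g=(g_1,\ldots,g_p)$. The value function is, for $x\in X$, $$\mathcal{Q}(x)=\inf\{f(y,x):y\in Y,\ Ay+Bx=b,\ g(y,x)\le0\}.$$ The Lagrangian is $L_x(y,\lambda,\mu)=f(y,x)+\lambda^T(Bx+Ay-b)+\mu^Tg(y,x)$, the dual function is $\theta_x(\lambda,\mu)=\inf_{y\in Y}L_x(y,\lambda,\mu)$, and $$\ell_2(\hat y,\bar x,\hat\lambda,\hat\mu)=\max_{y\in Y}\langle\nabla_yL_{\bar x}(\hat y,\hat\lambda,\hat\mu),\hat y-y\rangle .$$ $\nabla_xL_{\bar x}$ is the gradient of $x\mapsto L_x(y,\lambda,\mu)$ at $x=\bar x$. A cut for $\mathcal{Q}$ is an affine function $\mathcal{C}$ with $\mathcal{Q}(x)\ge\mathcal{C}(x)$ for all $x\in X$. An $\varepsilon$-optimal feasible solution is a feasible point whose objective value is within $\varepsilon$ of the optimal value. $\mathrm{Diam}(Y)=\max_{x,y\in Y}\|x-y\|$; $\mathrm{ri}$ denotes relative interior. The point $y_{\bar x}$ is the one provided by (H4) for $x=\bar x$. *)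

theory Defs
  imports "HOL-Analysis.Analysis"
begin

text \<open>
  A function with values in \<open>\<real> \<union> {+\<infinity>}\<close> is an \<^typ>\<open>ereal\<close>-valued function that avoids \<open>-\<infinity>\<close>.
  Functions of the pair of decisions take the argument \<open>(y, x)\<close>, in this order.
\<close>

definition avoids_minf :: "('a \<Rightarrow> ereal) \<Rightarrow> bool" where
  "avoids_minf f \<longleftrightarrow> (\<forall>z. f z \<noteq> -\<infinity>)"

definition proper :: "('a \<Rightarrow> ereal) \<Rightarrow> bool" where
  "proper f \<longleftrightarrow> avoids_minf f \<and> (\<exists>z. f z \<noteq> \<infinity>)"

definition lower_semicontinuous :: "('a::topological_space \<Rightarrow> ereal) \<Rightarrow> bool" where
  "lower_semicontinuous f \<longleftrightarrow> (\<forall>z. f z \<le> Liminf (at z) f)"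

text \<open>
  The analogue of \<^const>\<open>convex_on\<close> on the whole space. It is meant for functions that avoid
  \<open>-\<infinity>\<close>, for which the right-hand side is never of the form \<open>\<infinity> - \<infinity>\<close>.
\<close>

definition convex_ereal :: "('a::real_vector \<Rightarrow> ereal) \<Rightarrow> bool" where
  "convex_ereal f \<longleftrightarrow>
     (\<forall>z w. \<forall>u\<ge>0. \<forall>v\<ge>0. u + v = 1 \<longrightarrow>
        f (u *\<^sub>R z + v *\<^sub>R w) \<le> ereal u * f z + ereal v * f w)"

text \<open>
  Differentiability of an extended-real-valued function at a point includes finiteness in a
  neighbourhood; without it \<^const>\<open>real_of_ereal\<close> would turn \<open>\<infinity>\<close> into \<open>0\<close>.
\<close>

definition differentiable_ereal_at :: "('a::real_normed_vector \<Rightarrow> ereal) \<Rightarrow> 'a \<Rightarrow> bool" where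
  "differentiable_ereal_at f z \<longleftrightarrow>
     (\<forall>\<^sub>F w in nhds z. \<bar>f w\<bar> \<noteq> \<infinity>) \<and> (\<lambda>w. real_of_ereal (f w)) differentiable (at z)"

definition gradient :: "('a::real_inner \<Rightarrow> ereal) \<Rightarrow> 'a \<Rightarrow> 'a" where
  "gradient f z = (THE D. GDERIV (\<lambda>w. real_of_ereal (f w)) z :> D)"

definition eps_minimizer :: "real \<Rightarrow> 'a set \<Rightarrow> ('a \<Rightarrow> ereal) \<Rightarrow> 'a \<Rightarrow> bool" where
  "eps_minimizer \<epsilon> S h z \<longleftrightarrow> z \<in> S \<and> h z \<le> (INF w\<in>S. h w) + ereal \<epsilon>"

definition eps_maximizer :: "real \<Rightarrow> 'a set \<Rightarrow> ('a \<Rightarrow> ereal) \<Rightarrow> 'a \<Rightarrow> bool" where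
  "eps_maximizer \<epsilon> S h z \<longleftrightarrow> z \<in> S \<and> (SUP w\<in>S. h w) - ereal \<epsilon> \<le> h z"

definition feasible_set ::
    "('p::finite \<Rightarrow> (real^'n) \<times> (real^'m) \<Rightarrow> ereal) \<Rightarrow> real^'n^'q \<Rightarrow> real^'m^'q \<Rightarrow> real^'q
     \<Rightarrow> (real^'n) set \<Rightarrow> real^'m \<Rightarrow> (real^'n) set" where
  "feasible_set g A B b Y x = {y \<in> Y. A *v y + B *v x = b \<and> (\<forall>i. g i (y, x) \<le> 0)}"

definition value_function ::
    "((real^'n) \<times> (real^'m) \<Rightarrow> ereal) \<Rightarrow> ('p::finite \<Rightarrow> (real^'n) \<times> (real^'m) \<Rightarrow> ereal)
     \<Rightarrow> real^'n^'q \<Rightarrow> real^'m^'q \<Rightarrow> real^'q \<Rightarrow> (real^'n) set \<Rightarrow> real^'m \<Rightarrow> ereal" where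
  "value_function f g A B b Y x = (INF y\<in>feasible_set g A B b Y x. f (y, x))"

definition lagrangian ::
    "((real^'n) \<times> (real^'m) \<Rightarrow> ereal) \<Rightarrow> ('p::finite \<Rightarrow> (real^'n) \<times> (real^'m) \<Rightarrow> ereal)
     \<Rightarrow> real^'n^'q \<Rightarrow> real^'m^'q \<Rightarrow> real^'q
     \<Rightarrow> real^'m \<Rightarrow> real^'n \<Rightarrow> real^'q \<Rightarrow> real^'p \<Rightarrow> ereal" where
  "lagrangian f g A B b x y u \<mu> =
     f (y, x) + ereal (u \<bullet> (B *v x + A *v y - b)) + (\<Sum>i\<in>UNIV. ereal (\<mu> $ i) * g i (y, x))"

definition dual_function ::
    "((real^'n) \<times> (real^'m) \<Rightarrow> ereal) \<Rightarrow> ('p::finite \<Rightarrow> (real^'n) \<times> (real^'m) \<Rightarrow> ereal)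
     \<Rightarrow> real^'n^'q \<Rightarrow> real^'m^'q \<Rightarrow> real^'q \<Rightarrow> (real^'n) set
     \<Rightarrow> real^'m \<Rightarrow> (real^'q) \<times> (real^'p) \<Rightarrow> ereal" where
  "dual_function f g A B b Y x = (\<lambda>(u, \<mu>). INF y\<in>Y. lagrangian f g A B b x y u \<mu>)"

definition dual_feasible :: "((real^'q) \<times> (real^'p)) set" where
  "dual_feasible = {(u, \<mu>). \<forall>i. 0 \<le> \<mu> $ i}"

text \<open>The supremum is a maximum since \<open>Y\<close> will be nonempty and compact.\<close>

definition ell2 ::
    "((real^'n) \<times> (real^'m) \<Rightarrow> ereal) \<Rightarrow> ('p::finite \<Rightarrow> (real^'n) \<times> (real^'m) \<Rightarrow> ereal)
     \<Rightarrow> real^'n^'q \<Rightarrow> real^'m^'q \<Rightarrow> real^'q \<Rightarrow> (real^'n) set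
     \<Rightarrow> real^'n \<Rightarrow> real^'m \<Rightarrow> real^'q \<Rightarrow> real^'p \<Rightarrow> real" where
  "ell2 f g A B b Y y0 x0 u \<mu> =
     (SUP y\<in>Y. gradient (\<lambda>y. lagrangian f g A B b x0 y u \<mu>) y0 \<bullet> (y0 - y))"

definition is_cut :: "(real^'m) set \<Rightarrow> (real^'m \<Rightarrow> ereal) \<Rightarrow> (real^'m \<Rightarrow> real) \<Rightarrow> bool" where
  "is_cut X Q C \<longleftrightarrow>
     (\<exists>a c. \<forall>x. C x = a \<bullet> x + c) \<and> (\<forall>x\<in>X. Q x \<ge> ereal (C x))"

end

theory Submission
  imports Defs
begin

text \<open>
  Write \<open>\<phi>\<close> for the Lagrangian at \<open>xb\<close> with the given multipliers \<open>(lh, mh)\<close>, as a function of \<open>y\<close>.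

  The affine function is a cut because, for nonnegative \<open>mh\<close>, the Lagrangian is jointly convex in
  \<open>(y, x)\<close> and below the objective on every feasible set. Its tangent plane at \<open>(yh, xb)\<close> is therefore
  below the objective (\<open>lagrangian_above_tangent\<close>, \<open>lagrangian_le_objective\<close>), and \<open>-\<ell>\<^sub>2\<close> is the
  least value over \<open>Y\<close> of the part of that plane that depends on \<open>y\<close>.

  For the distance at \<open>xb\<close>, note that \<open>\<C>(xb) = \<phi>(yh) - \<ell>\<^sub>2\<close>, so a lower bound on \<open>\<phi>(yh) - \<Q>(xb)\<close>
  is required. Slater's condition gives strong duality (\<open>slater_multipliers\<close>,
  \<open>value_function_le_sup_dual\<close>), so that \<open>\<phi> \<ge> \<Q>(xb) - \<epsilon>\<close> on the whole of \<open>Y\<close>. On the other hand, one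
  Frank--Wolfe step from \<open>yh\<close> decreases \<open>\<phi>\<close> by an amount depending only on \<open>\<ell>\<^sub>2\<close>, the
  diameter of \<open>Y\<close> and the Lipschitz constant of \<open>\<nabla>\<phi>\<close> (\<open>frank_wolfe_decrease\<close>); since the value after
  the step is still at least \<open>\<Q>(xb) - \<epsilon>\<close>, the value \<open>\<phi>(yh)\<close> exceeds \<open>\<Q>(xb) - \<epsilon>\<close> by at least that amount.

  The Lipschitz constant is at most \<open>M1 + (\<Sum>i. mh $ i) * M2\<close>. Evaluating \<open>\<phi>\<close> at the Slater point
  bounds the sum of the multipliers (\<open>sum_multipliers_le\<close>), which yields \<open>M3\<close>.
\<close>

section \<open>Gradients of extended-real-valued functions\<close>

lemma gradient_eqI:
  assumes "GDERIV (\<lambda>w. real_of_ereal (h w)) z :> D"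
  shows "gradient h z = D"
  unfolding gradient_def
proof (rule the_equality)
  fix E assume "GDERIV (\<lambda>w. real_of_ereal (h w)) z :> E"
  then have "(\<lambda>v. v \<bullet> E) = (\<lambda>v. v \<bullet> D)"
    unfolding gderiv_def using assms[unfolded gderiv_def] by (rule has_derivative_unique)
  then show "E = D" by (metis vector_eq_ldot)
qed (fact assms)

lemma differentiable_imp_GDERIV:
  fixes h :: "'a::euclidean_space \<Rightarrow> real"
  assumes "h differentiable (at z)"
  shows "\<exists>D. GDERIV h z :> D"
proof -
  obtain h' where h': "(h has_derivative h') (at z)"
    using assms unfolding differentiable_def by blast
  have "linear h'" using h' has_derivative_linear by blast
  define D where "D = adjoint h' 1"
  have "h' = (\<lambda>v. v \<bullet> D)"
    using adjoint_works[OF \<open>linear h'\<close>, of _ 1] by (simp add: fun_eq_iff D_def)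
  then show ?thesis using h' unfolding gderiv_def by auto
qed

lemma GDERIV_gradient:
  fixes h :: "'a::euclidean_space \<Rightarrow> ereal"
  assumes "differentiable_ereal_at h z"
  shows "GDERIV (\<lambda>w. real_of_ereal (h w)) z :> gradient h z"
proof -
  obtain D where D: "GDERIV (\<lambda>w. real_of_ereal (h w)) z :> D"
    using assms differentiable_imp_GDERIV unfolding differentiable_ereal_at_def by blast
  then show ?thesis using gradient_eqI[OF D] by simp
qed

lemma differentiable_ereal_at_finite:
  assumes "differentiable_ereal_at h z"
  shows "\<bar>h z\<bar> \<noteq> \<infinity>"
proof -
  have "\<forall>\<^sub>F w in nhds z. \<bar>h w\<bar> \<noteq> \<infinity>" using assms by (simp add: differentiable_ereal_at_def)
  then show ?thesis by (rule eventually_nhds_x_imp_x)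
qed

text \<open>
  The real value of an extended-real expression is usually known only near the point, where all terms
  are finite; this is enough to transfer a derivative.
\<close>

lemma has_derivative_transform_nhds:
  assumes "(r has_derivative r') (at z)" "\<forall>\<^sub>F w in nhds z. h w = r w"
  shows "(h has_derivative r') (at z)"
proof (rule has_derivative_transform_eventually[OF assms(1)])
  show "\<forall>\<^sub>F w in at z. r w = h w"
    using assms(2) unfolding eventually_at_filter by eventually_elim simp
  show "r z = h z" using eventually_nhds_x_imp_x[OF assms(2)] by simp
qed simp

lemma GDERIV_slices:
  assumes "GDERIV h (y, x) :> (dy, dx)"
  shows "GDERIV (\<lambda>y. h (y, x)) y :> dy" and "GDERIV (\<lambda>x. h (y, x)) x :> dx"
proof -
  have h: "(h has_derivative (\<lambda>v. v \<bullet> (dy, dx))) (at (y, x))"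
    using assms unfolding gderiv_def .
  have "((\<lambda>y. h (y, x)) has_derivative (\<lambda>v. (v, 0) \<bullet> (dy, dx))) (at y)"
    by (rule has_derivative_compose[where f = "\<lambda>y. (y, x)" and g = h])
      (auto intro!: derivative_eq_intros h)
  then show "GDERIV (\<lambda>y. h (y, x)) y :> dy" unfolding gderiv_def by simp
  have "((\<lambda>x. h (y, x)) has_derivative (\<lambda>v. (0, v) \<bullet> (dy, dx))) (at x)"
    by (rule has_derivative_compose[where f = "\<lambda>x. (y, x)" and g = h])
      (auto intro!: derivative_eq_intros h)
  then show "GDERIV (\<lambda>x. h (y, x)) x :> dx" unfolding gderiv_def by simp
qed

text \<open>
  Joint convexity yields a tangent inequality for the joint gradient, whereas the cut and the gap
  \<open>\<ell>\<^sub>2\<close> are built from the two partial gradients; this is the bridge between them.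
\<close>

lemma gradient_Pair:
  fixes h :: "'a::euclidean_space \<times> 'b::euclidean_space \<Rightarrow> ereal"
  assumes "differentiable_ereal_at h (y, x)"
  shows "gradient h (y, x) = (gradient (\<lambda>y. h (y, x)) y, gradient (\<lambda>x. h (y, x)) x)"
proof -
  obtain dy dx where D: "gradient h (y, x) = (dy, dx)" by (cases "gradient h (y, x)")
  then have "GDERIV (\<lambda>w. real_of_ereal (h w)) (y, x) :> (dy, dx)"
    using GDERIV_gradient[OF assms] by simp
  from GDERIV_slices[OF this] show ?thesis using D gradient_eqI[of "\<lambda>y. h (y, x)" y dy]
    gradient_eqI[of "\<lambda>x. h (y, x)" x dx] by simp
qed

lemma differentiable_ereal_at_slice:
  assumes "differentiable_ereal_at h (y, x)"
  shows "differentiable_ereal_at (\<lambda>y. h (y, x)) y"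
proof -
  have ev: "\<forall>\<^sub>F w in nhds (y, x). \<bar>h w\<bar> \<noteq> \<infinity>"
    and d: "(\<lambda>w. real_of_ereal (h w)) differentiable (at (y, x))"
    using assms by (simp_all add: differentiable_ereal_at_def)
  have "((\<lambda>y. (y, x)) \<longlongrightarrow> (y, x)) (nhds y)"
    by (rule tendsto_Pair[OF filterlim_ident tendsto_const])
  then have "\<forall>\<^sub>F y in nhds y. \<bar>h (y, x)\<bar> \<noteq> \<infinity>"
    by (rule eventually_compose_filterlim[OF ev])
  moreover have "(\<lambda>y. real_of_ereal (h (y, x))) differentiable (at y)"
  proof -
    have "(\<lambda>y. (y, x)) differentiable (at y)"
      unfolding differentiable_def by (auto intro!: exI derivative_eq_intros)
    from differentiable_chain_at[OF this d] show ?thesis by (simp add: o_def)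
  qed
  ultimately show ?thesis unfolding differentiable_ereal_at_def by (rule conjI)
qed

section \<open>First-order inequalities\<close>

lemma convex_on_real_of_ereal:
  assumes "convex_ereal h" "convex S" "\<And>z. z \<in> S \<Longrightarrow> \<bar>h z\<bar> \<noteq> \<infinity>"
  shows "convex_on S (\<lambda>z. real_of_ereal (h z))"
  unfolding convex_on_def
proof (intro conjI ballI allI impI)
  fix z w and u v :: real
  assume zw: "z \<in> S" "w \<in> S" and uv: "u \<ge> 0" "v \<ge> 0" "u + v = 1"
  have m: "u *\<^sub>R z + v *\<^sub>R w \<in> S" using assms(2) zw uv convexD by blast
  have "h (u *\<^sub>R z + v *\<^sub>R w) \<le> ereal u * h z + ereal v * h w"
    using assms(1) uv unfolding convex_ereal_def by blast
  moreover have "h k = ereal (real_of_ereal (h k))" if "k \<in> S" for k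
    using assms(3)[OF that] by (simp add: ereal_real)
  ultimately show "real_of_ereal (h (u *\<^sub>R z + v *\<^sub>R w))
      \<le> u * real_of_ereal (h z) + v * real_of_ereal (h w)"
    using zw m by (metis ereal_less_eq(3) plus_ereal.simps(1) times_ereal.simps(1))
qed (fact assms(2))

lemma GDERIV_line:
  assumes "GDERIV h (z + t *\<^sub>R v) :> D"
  shows "((\<lambda>t. h (z + t *\<^sub>R v)) has_real_derivative D \<bullet> v) (at t)"
proof -
  have "(h has_derivative (\<lambda>v. v \<bullet> D)) (at (z + t *\<^sub>R v))"
    using assms unfolding gderiv_def .
  then have "((\<lambda>t. h (z + t *\<^sub>R v)) has_derivative (\<lambda>s. (s *\<^sub>R v) \<bullet> D)) (at t)"
    by (rule has_derivative_compose[where g = h, rotated]) (auto intro!: derivative_eq_intros)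
  moreover have "(\<lambda>s. (s *\<^sub>R v) \<bullet> D) = (*) (D \<bullet> v)"
    by (simp add: fun_eq_iff inner_commute)
  ultimately show ?thesis unfolding has_field_derivative_def by simp
qed

text \<open>
  The difference quotient along the segment from \<open>z\<close> to \<open>w\<close> is at most \<open>h w - h z\<close>, and its limit
  is the directional derivative. The base point may lie on the boundary of \<open>S\<close>: approximate
  solutions of a constrained problem often do.
\<close>

lemma convex_on_above_tangent:
  fixes h :: "'a::real_inner \<Rightarrow> real"
  assumes "convex_on S h" "GDERIV h z :> D" "z \<in> S" "w \<in> S"
  shows "h z + D \<bullet> (w - z) \<le> h w"
proof -
  have "((\<lambda>t. h (z + t *\<^sub>R (w - z))) has_real_derivative D \<bullet> (w - z)) (at 0)"
    by (rule GDERIV_line) (simp add: assms(2))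
  then have "((\<lambda>t. (h (z + t *\<^sub>R (w - z)) - h z) / t) \<longlongrightarrow> D \<bullet> (w - z)) (at_right 0)"
    unfolding DERIV_def by (simp add: filterlim_at_split)
  moreover have "\<forall>\<^sub>F t in at_right 0. (h (z + t *\<^sub>R (w - z)) - h z) / t \<le> h w - h z"
    using eventually_at_right_less eventually_at_right_real[OF zero_less_one]
  proof eventually_elim
    case (elim t)
    have "h ((1 - t) *\<^sub>R z + t *\<^sub>R w) \<le> (1 - t) * h z + t * h w"
      using convex_onD[OF assms(1)] elim assms(3,4) by auto
    moreover have "z + t *\<^sub>R (w - z) = (1 - t) *\<^sub>R z + t *\<^sub>R w" by (simp add: algebra_simps)
    ultimately have "h (z + t *\<^sub>R (w - z)) - h z \<le> t * (h w - h z)" by (simp add: algebra_simps)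
    then show ?case using elim by (simp add: field_simps)
  qed
  ultimately have "D \<bullet> (w - z) \<le> h w - h z" by (rule tendsto_upperbound) simp
  then show ?thesis by simp
qed

text \<open>
  Along the segment the derivative of \<open>h\<close> grows at most linearly, with slope
  \<open>M \<parallel>z - y\<parallel>\<^sup>2\<close>. Subtracting the corresponding quadratic from \<open>h\<close> leaves a nonincreasing function.
\<close>

lemma lipschitz_gradient_upper_bound:
  fixes h :: "'a::real_inner \<Rightarrow> real"
  assumes "convex S" "\<And>y. y \<in> S \<Longrightarrow> GDERIV h y :> D y"
    and "\<And>y z. \<lbrakk>y \<in> S; z \<in> S\<rbrakk> \<Longrightarrow> norm (D z - D y) \<le> M * norm (z - y)"
    and "y \<in> S" "z \<in> S"
  shows "h z \<le> h y + D y \<bullet> (z - y) + M / 2 * (norm (z - y))\<^sup>2"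
proof -
  define k where "k t = h (y + t *\<^sub>R (z - y)) - t * (D y \<bullet> (z - y)) - M / 2 * t\<^sup>2 * (norm (z - y))\<^sup>2"
    for t :: real
  have "k 1 \<le> k 0"
  proof (rule DERIV_nonpos_imp_nonincreasing[of 0 1])
    fix t :: real assume t: "0 \<le> t" "t \<le> 1"
    let ?p = "y + t *\<^sub>R (z - y)"
    have p: "?p \<in> S"
      using convexD[OF assms(1,4,5), of "1 - t" t] t by (simp add: algebra_simps)
    have "((\<lambda>t. h (y + t *\<^sub>R (z - y))) has_real_derivative D ?p \<bullet> (z - y)) (at t)"
      by (rule GDERIV_line) (rule assms(2)[OF p])
    then have "(k has_field_derivative
        D ?p \<bullet> (z - y) - D y \<bullet> (z - y) - M * t * (norm (z - y))\<^sup>2) (at t)"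
      unfolding k_def by (auto intro!: derivative_eq_intros)
    moreover have "D ?p \<bullet> (z - y) - D y \<bullet> (z - y) \<le> M * t * (norm (z - y))\<^sup>2"
    proof -
      have "D ?p \<bullet> (z - y) - D y \<bullet> (z - y) \<le> norm (D ?p - D y) * norm (z - y)"
        by (metis inner_diff_left norm_cauchy_schwarz)
      also have "\<dots> \<le> (M * norm (?p - y)) * norm (z - y)"
        using assms(3)[OF assms(4) p] by (rule mult_right_mono) simp
      finally show ?thesis using t by (simp add: power2_eq_square)
    qed
    ultimately show "\<exists>d. (k has_real_derivative d) (at t) \<and> d \<le> 0" by force
  qed simp
  then show ?thesis by (simp add: k_def)
qed

text \<open>
  A Frank--Wolfe step moves from \<open>y\<close> towards a maximiser \<open>z\<close> of \<open>D y \<bullet> (y - z)\<close>, where the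
  linearisation of \<open>h\<close> drops by the full gap; the Lipschitz bound controls its error. A step of length
  \<open>t\<close> gains at least \<open>t gap - M t\<^sup>2 d\<^sup>2 / 2\<close> with \<open>d\<close> the diameter. The two cases are the maximiser
  of this quadratic in \<open>t\<close> over \<open>[0, 1]\<close>: either the vertex or the endpoint \<open>1\<close>,
  where \<open>M d\<^sup>2 < gap\<close> leaves a gain of more than \<open>gap / 2\<close>.
\<close>

lemma frank_wolfe_decrease:
  fixes h :: "'a::real_inner \<Rightarrow> real"
  assumes "convex S" "compact S" "\<And>y. y \<in> S \<Longrightarrow> GDERIV h y :> D y"
    and "\<And>y z. \<lbrakk>y \<in> S; z \<in> S\<rbrakk> \<Longrightarrow> norm (D z - D y) \<le> M * norm (z - y)"
    and "y \<in> S" "M > 0"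
  defines "gap \<equiv> (SUP z\<in>S. D y \<bullet> (y - z))"
  shows "\<exists>w\<in>S. h w \<le> h y - (if gap \<le> M * (diameter S)\<^sup>2
                             then gap\<^sup>2 / (2 * M * (diameter S)\<^sup>2) else gap / 2)"
proof -
  let ?d = "diameter S"
  have "continuous_on S (\<lambda>z. D y \<bullet> (y - z))" by (intro continuous_intros)
  then obtain z where z: "z \<in> S" "\<forall>w\<in>S. D y \<bullet> (y - w) \<le> D y \<bullet> (y - z)"
    using continuous_attains_sup[OF assms(2)] assms(5) by blast
  have gap: "gap = D y \<bullet> (y - z)"
    unfolding gap_def using z by (intro cSup_eq_maximum) auto
  have gap0: "gap \<ge> 0" using z assms(5) unfolding gap by force
  have yz: "norm (z - y) \<le> ?d"
    using diameter_bounded_bound[OF compact_imp_bounded[OF assms(2)] z(1) assms(5)]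
    by (simp add: dist_norm)
  have step: "\<exists>w\<in>S. h w \<le> h y - t * gap + M / 2 * t\<^sup>2 * ?d\<^sup>2" if t: "0 \<le> t" "t \<le> 1" for t
  proof -
    let ?w = "y + t *\<^sub>R (z - y)"
    have w: "?w \<in> S"
      using convexD[OF assms(1) \<open>y \<in> S\<close> z(1), of "1 - t" t] t by (simp add: algebra_simps)
    have "h ?w \<le> h y + D y \<bullet> (?w - y) + M / 2 * (norm (?w - y))\<^sup>2"
      by (rule lipschitz_gradient_upper_bound[OF assms(1,3,4,5) w])
    also have "D y \<bullet> (?w - y) = - t * gap" unfolding gap by (simp add: inner_diff_right algebra_simps)
    also have "M / 2 * (norm (?w - y))\<^sup>2 \<le> M / 2 * (t\<^sup>2 * ?d\<^sup>2)"
      using yz \<open>M > 0\<close> t by (auto simp: power_mult_distrib intro!: mult_left_mono power_mono)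
    finally show ?thesis using w by (intro bexI[of _ ?w]) (auto simp: algebra_simps)
  qed
  show ?thesis
  proof (cases "?d = 0")
    case True
    \<comment> \<open>\<open>S\<close> is a single point, so the gap is \<open>0\<close> and the division by \<open>0\<close> yields \<open>0\<close>\<close>
    then show ?thesis using assms(5) yz gap gap0 by auto
  next
    case False
    then have d: "?d > 0" using yz norm_ge_zero[of "z - y"] by linarith
    then have Md: "M * ?d\<^sup>2 > 0" using \<open>M > 0\<close> by simp
    show ?thesis
    proof (cases "gap \<le> M * ?d\<^sup>2")
      case True
      \<comment> \<open>the vertex of the quadratic \<open>t gap - M t\<^sup>2 d\<^sup>2 / 2\<close>\<close>
      define t where "t = gap / (M * ?d\<^sup>2)"
      have "0 \<le> t" "t \<le> 1" using gap0 True Md by (auto simp: t_def)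
      moreover have "h y - t * gap + M / 2 * t\<^sup>2 * ?d\<^sup>2 = h y - (gap\<^sup>2 / (2 * M * ?d\<^sup>2))"
        using d \<open>M > 0\<close> by (simp add: t_def field_simps power2_eq_square)
      ultimately obtain w where "w \<in> S" "h w \<le> h y - (gap\<^sup>2 / (2 * M * ?d\<^sup>2))"
        using step[of t] by metis
      then show ?thesis using True by auto
    next
      case False
      moreover obtain w where "w \<in> S" "h w \<le> h y - gap + M / 2 * ?d\<^sup>2"
        using step[of 1] by auto
      ultimately show ?thesis by (intro bexI[of _ w]) auto
    qed
  qed
qed

section \<open>Existence of multipliers under Slater's condition\<close>

lemma nonneg_slope:
  fixes K :: real
  assumes "\<And>t. t \<ge> 0 \<Longrightarrow> 0 \<le> K + s * t"
  shows "0 \<le> s"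
proof (rule ccontr)
  assume "\<not> 0 \<le> s"
  then have s: "s < 0" by simp
  have "0 \<le> K + s * ((\<bar>K\<bar> + 1) / (- s))" using s by (intro assms) (simp add: field_simps)
  moreover have "s * ((\<bar>K\<bar> + 1) / (- s)) = - (\<bar>K\<bar> + 1)" using s by simp
  ultimately show False by linarith
qed

text \<open>
  The set \<open>S\<close> of all triples (equality residual, upper bound on the constraints, strict upper
  bound on the excess cost over \<open>q\<close>) is convex, and \<open>0 \<notin> S\<close> says that no feasible point costs less
  than \<open>q\<close>. A separating functional \<open>(u, m, k)\<close> has \<open>m, k \<ge> 0\<close> because \<open>S\<close> is closed under
  increasing the last two components; when \<open>k > 0\<close>, dividing by \<open>k\<close> gives the multipliers.

  Slater's condition excludes \<open>k = 0\<close>. In that case the strict inequalities at \<open>s\<close> force \<open>m = 0\<close>.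
  Then \<open>u \<bullet> (A y - c)\<close> is nonnegative on \<open>Y\<close> and vanishes at the relative interior point \<open>s\<close>, hence
  vanishes on all of \<open>Y\<close>, so that the functional is orthogonal to \<open>S\<close>. Choosing the functional in the
  span of \<open>S\<close> makes this contradictory even when \<open>A\<close> does not have full row rank.
\<close>

lemma slater_multipliers:
  fixes A :: "'a::euclidean_space \<Rightarrow> 'b::euclidean_space" and F :: "'a \<Rightarrow> real"
    and G :: "'p::finite \<Rightarrow> 'a \<Rightarrow> real"
  assumes "convex Y" "convex_on Y F" "\<And>i. convex_on Y (G i)" "linear A"
    and slater: "s \<in> rel_interior Y" "A s = c" "\<And>i. G i s < 0"
    and lower: "\<And>y. \<lbrakk>y \<in> Y; A y = c; \<forall>i. G i y \<le> 0\<rbrakk> \<Longrightarrow> q \<le> F y"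
  obtains u and \<mu> :: "real^'p"
  where "\<And>i. 0 \<le> \<mu> $ i"
    and "\<And>y. y \<in> Y \<Longrightarrow> q \<le> F y + u \<bullet> (A y - c) + (\<Sum>i\<in>UNIV. \<mu> $ i * G i y)"
proof -
  interpret A: linear A by fact
  have sY: "s \<in> Y" using slater(1) rel_interior_subset by blast
  define S :: "('b \<times> (real^'p) \<times> real) set" where
    "S = {(w, v, r). \<exists>y\<in>Y. w = A y - c \<and> (\<forall>i. G i y \<le> v $ i) \<and> F y - q < r}"
  have "convex S"
  proof (rule convexI)
    fix z1 z2 and t1 t2 :: real
    assume z: "z1 \<in> S" "z2 \<in> S" and t: "0 \<le> t1" "0 \<le> t2" "t1 + t2 = 1"
    obtain v1 r1 y1 where 1: "z1 = (A y1 - c, v1, r1)" "y1 \<in> Y" "\<And>i. G i y1 \<le> v1 $ i" "F y1 - q < r1"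
      using z(1) unfolding S_def by auto
    obtain v2 r2 y2 where 2: "z2 = (A y2 - c, v2, r2)" "y2 \<in> Y" "\<And>i. G i y2 \<le> v2 $ i" "F y2 - q < r2"
      using z(2) unfolding S_def by auto
    let ?y = "t1 *\<^sub>R y1 + t2 *\<^sub>R y2"
    have y: "?y \<in> Y" using convexD[OF assms(1)] 1 2 t by blast
    have "t1 *\<^sub>R c + t2 *\<^sub>R c = c" using t by (simp flip: scaleR_left_distrib)
    then have "t1 *\<^sub>R (A y1 - c) + t2 *\<^sub>R (A y2 - c) = A ?y - c"
      by (simp add: A.add A.scaleR algebra_simps)
    moreover have "G i ?y \<le> (t1 *\<^sub>R v1 + t2 *\<^sub>R v2) $ i" for i
    proof -
      have "G i ?y \<le> t1 * G i y1 + t2 * G i y2"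
        using assms(3)[of i] 1 2 t unfolding convex_on_def by blast
      also have "\<dots> \<le> t1 * v1 $ i + t2 * v2 $ i"
        using 1 2 t by (intro add_mono mult_left_mono) auto
      finally show ?thesis by simp
    qed
    moreover have "F ?y - q < t1 * r1 + t2 * r2"
    proof -
      have "F ?y \<le> t1 * F y1 + t2 * F y2"
        using assms(2) 1 2 t unfolding convex_on_def by blast
      moreover have "t1 * (F y1 - q) + t2 * (F y2 - q) < t1 * r1 + t2 * r2"
      proof (cases "t1 = 0")
        case True then show ?thesis using 2 t by simp
      next
        case False
        then have "t1 * (F y1 - q) < t1 * r1" using 1 t by simp
        moreover have "t2 * (F y2 - q) \<le> t2 * r2" using 2 t by (intro mult_left_mono) auto
        ultimately show ?thesis by simp
      qed
      moreover have "t1 * q + t2 * q = q" using t by (simp flip: distrib_right)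
      ultimately show ?thesis by (simp add: algebra_simps)
    qed
    ultimately show "t1 *\<^sub>R z1 + t2 *\<^sub>R z2 \<in> S"
      unfolding S_def 1 2 using y by (auto intro!: bexI[of _ ?y])
  qed
  moreover have "(A s - c, \<chi> i. G i s, F s - q + 1) \<in> S" unfolding S_def using sY by auto
  then have "S \<noteq> {}" by blast
  moreover have "0 \<notin> S" unfolding S_def zero_prod_def using lower by force
  ultimately obtain a where a: "a \<in> span S" "a \<noteq> 0" "\<And>z. z \<in> S \<Longrightarrow> 0 \<le> a \<bullet> z"
    by (rule separating_hyperplane_set_0_inspan) blast
  obtain u m k where a_eq: "a = (u, m, k)" by (cases a)
  have sep: "0 \<le> u \<bullet> (A y - c) + m \<bullet> v + k * r"
    if "y \<in> Y" "\<And>i. G i y \<le> v $ i" "F y - q < r" for y v r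
    using a(3)[of "(A y - c, v, r)"] that unfolding a_eq S_def by (auto simp: add.assoc)
  have k0: "0 \<le> k"
  proof (rule nonneg_slope)
    fix t :: real assume "t \<ge> 0"
    then show "0 \<le> (m \<bullet> (\<chi> i. G i s) + k * (F s - q + 1)) + k * t"
      using sep[OF sY, of "\<chi> i. G i s" "F s - q + 1 + t"] slater by (simp add: algebra_simps)
  qed
  have m0: "0 \<le> m $ i" for i
  proof (rule nonneg_slope)
    fix t :: real assume "t \<ge> 0"
    then have "0 \<le> m \<bullet> ((\<chi> i. G i s) + t *\<^sub>R axis i 1) + k * (F s - q + 1)"
      using sep[OF sY, of "(\<chi> i. G i s) + t *\<^sub>R axis i 1" "F s - q + 1"] slater
      by (simp add: axis_def)
    then show "0 \<le> (m \<bullet> (\<chi> i. G i s) + k * (F s - q + 1)) + m $ i * t"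
      by (simp add: inner_right_distrib inner_axis algebra_simps)
  qed
  have main: "0 \<le> u \<bullet> (A y - c) + (\<Sum>i\<in>UNIV. m $ i * G i y) + k * (F y - q)" (is "0 \<le> ?K")
    if "y \<in> Y" for y
  proof -
    have e: "0 \<le> ?K + k * e" if "e > 0" for e
      using sep[OF \<open>y \<in> Y\<close>, of "\<chi> i. G i y" "F y - q + e"] that
      by (simp add: inner_vec_def algebra_simps)
    show ?thesis
    proof (cases "k = 0")
      case True then show ?thesis using e[of 1] by simp
    next
      case False
      then have k: "k > 0" using k0 by simp
      show ?thesis
      proof (rule field_le_epsilon)
        fix e :: real assume "e > 0"
        then show "0 \<le> ?K + e" using e[of "e / k"] k by simp
      qed
    qed
  qed
  have "k \<noteq> 0"
  proof
    assume k: "k = 0"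
    have "0 \<le> (\<Sum>i\<in>UNIV. m $ i * G i s)" using main[OF sY] slater k by simp
    moreover have neg: "m $ i * G i s \<le> 0" for i
      using m0 slater(3)[of i] by (simp add: mult_nonneg_nonpos)
    then have "(\<Sum>i\<in>UNIV. m $ i * G i s) \<le> 0" by (simp add: sum_nonpos)
    ultimately have "(\<Sum>i\<in>UNIV. - (m $ i * G i s)) = 0" by (simp add: sum_negf)
    then have "\<forall>i. m $ i * G i s = 0"
      using neg by (subst (asm) sum_nonneg_eq_0_iff) auto
    then have m: "m = 0" using slater(3) by (simp add: vec_eq_iff) (metis less_irrefl)
    \<comment> \<open>prolong the segment from \<open>y\<close> through \<open>s\<close> beyond \<open>s\<close>, where the sign is reversed\<close>
    have "u \<bullet> (A y - c) = 0" if y: "y \<in> Y" for y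
    proof -
      obtain e where e: "e > 1" "(1 - e) *\<^sub>R y + e *\<^sub>R s \<in> Y"
        using slater(1) convex_rel_interior_iff[OF assms(1)] y by blast
      have "A ((1 - e) *\<^sub>R y + e *\<^sub>R s) - c = (1 - e) *\<^sub>R (A y - c)"
        by (simp add: A.add A.scaleR slater(2)) (simp add: algebra_simps)
      then have "0 \<le> (1 - e) * (u \<bullet> (A y - c))" using main[OF e(2)] k m by simp
      then have "u \<bullet> (A y - c) \<le> 0" using e(1) by (simp add: zero_le_mult_iff)
      then show ?thesis using main[OF y] k m by simp
    qed
    then have "orthogonal a z" if "z \<in> S" for z
      using that unfolding S_def orthogonal_def a_eq k m by auto
    then have "orthogonal a a" using a(1) orthogonal_to_span by blast
    then show False using a(2) by (simp add: orthogonal_def)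
  qed
  then have k: "k > 0" using k0 by simp
  show thesis
  proof (rule that[of "m /\<^sub>R k" "u /\<^sub>R k"])
    show "0 \<le> (m /\<^sub>R k) $ i" for i using m0 k by simp
    fix y assume "y \<in> Y"
    then have "0 \<le> (u \<bullet> (A y - c) + (\<Sum>i\<in>UNIV. m $ i * G i y) + k * (F y - q)) / k"
      using main k by simp
    also have "\<dots> = (u \<bullet> (A y - c)) / k + (\<Sum>i\<in>UNIV. m $ i * G i y) / k + (F y - q)"
      using k by (simp add: add_divide_distrib)
    also have "(u \<bullet> (A y - c)) / k = (u /\<^sub>R k) \<bullet> (A y - c)"
      by (simp add: divide_inverse mult.commute)
    also have "(\<Sum>i\<in>UNIV. m $ i * G i y) / k = (\<Sum>i\<in>UNIV. (m /\<^sub>R k) $ i * G i y)"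
      by (simp add: divide_inverse sum_distrib_left mult_ac)
    finally show "q \<le> F y + (u /\<^sub>R k) \<bullet> (A y - c) + (\<Sum>i\<in>UNIV. (m /\<^sub>R k) $ i * G i y)" by simp
  qed
qed

section \<open>The Lagrangian\<close>

lemma convex_ereal_slice:
  assumes "convex_ereal h"
  shows "convex_ereal (\<lambda>y. h (y, x))"
  unfolding convex_ereal_def
proof (intro allI impI)
  fix y w and u v :: real
  assume "u \<ge> 0" "v \<ge> 0" "u + v = 1"
  moreover from this have "u *\<^sub>R x + v *\<^sub>R x = x" by (simp flip: scaleR_left_distrib)
  ultimately show "h (u *\<^sub>R y + v *\<^sub>R w, x) \<le> ereal u * h (y, x) + ereal v * h (w, x)"
    using assms[unfolded convex_ereal_def, rule_format, of u v "(y, x)" "(w, x)"] by simp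
qed

lemma lagrangian_eq_ereal:
  assumes "\<bar>f (y, x)\<bar> \<noteq> \<infinity>" "\<And>i. \<bar>g i (y, x)\<bar> \<noteq> \<infinity>"
  shows "lagrangian f g A B b x y u \<mu> =
    ereal (real_of_ereal (f (y, x)) + u \<bullet> (B *v x + A *v y - b)
      + (\<Sum>i\<in>UNIV. \<mu> $ i * real_of_ereal (g i (y, x))))"
proof -
  have "ereal (\<mu> $ i) * g i (y, x) = ereal (\<mu> $ i * real_of_ereal (g i (y, x)))" for i
    using assms(2)[of i] by (cases "g i (y, x)") auto
  moreover obtain r where "f (y, x) = ereal r" using assms(1) by (cases "f (y, x)") auto
  ultimately show ?thesis unfolding lagrangian_def by simp
qed

text \<open>
  Joint differentiability in \<open>(y, x)\<close> is the useful form: both partial gradients and the joint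
  tangent inequality follow from it.
\<close>

lemma differentiable_lagrangian:
  assumes "differentiable_ereal_at f z" "\<And>i. differentiable_ereal_at (g i) z"
  shows "differentiable_ereal_at (\<lambda>(y, x). lagrangian f g A B b x y u \<mu>) z"
proof -
  let ?r = "\<lambda>z. real_of_ereal (f z) + u \<bullet> (B *v snd z + A *v fst z - b)
      + (\<Sum>i\<in>UNIV. \<mu> $ i * real_of_ereal (g i z))"
  have "\<forall>\<^sub>F w in nhds z. \<bar>f w\<bar> \<noteq> \<infinity> \<and> (\<forall>i. \<bar>g i w\<bar> \<noteq> \<infinity>)"
    using assms by (simp add: differentiable_ereal_at_def eventually_conj_iff eventually_all_finite)
  then have ev: "\<forall>\<^sub>F w in nhds z. (\<lambda>(y, x). lagrangian f g A B b x y u \<mu>) w = ereal (?r w)"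
    by eventually_elim (auto simp: lagrangian_eq_ereal)
  have lin: "(\<lambda>z. u \<bullet> (B *v snd z + A *v fst z - b)) differentiable (at z)"
  proof -
    have "((\<lambda>z. u \<bullet> (B *v snd z + A *v fst z - b)) has_derivative
        (\<lambda>v. u \<bullet> (B *v snd v + A *v fst v))) (at z)"
      by (auto intro!: derivative_eq_intros
          bounded_linear.has_derivative[OF matrix_vector_mul_bounded_linear])
    then show ?thesis unfolding differentiable_def by blast
  qed
  have "?r differentiable (at z)"
    using assms lin unfolding differentiable_ereal_at_def
    by (intro differentiable_add differentiable_sum ballI differentiable_mult) auto
  then obtain r' where "(?r has_derivative r') (at z)" unfolding differentiable_def by blast
  moreover have "\<forall>\<^sub>F w in nhds z. real_of_ereal ((\<lambda>(y, x). lagrangian f g A B b x y u \<mu>) w) = ?r w"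
    using ev by eventually_elim simp
  ultimately have "((\<lambda>w. real_of_ereal ((\<lambda>(y, x). lagrangian f g A B b x y u \<mu>) w))
      has_derivative r') (at z)"
    by (rule has_derivative_transform_nhds)
  moreover have "\<forall>\<^sub>F w in nhds z. \<bar>(\<lambda>(y, x). lagrangian f g A B b x y u \<mu>) w\<bar> \<noteq> \<infinity>"
    using ev by eventually_elim simp
  ultimately show ?thesis unfolding differentiable_ereal_at_def differentiable_def by blast
qed

lemma GDERIV_lagrangian:
  assumes "differentiable_ereal_at f (y, x)" "\<And>i. differentiable_ereal_at (g i) (y, x)"
  shows "GDERIV (\<lambda>y. real_of_ereal (lagrangian f g A B b x y u \<mu>)) y :>
    gradient (\<lambda>y. lagrangian f g A B b x y u \<mu>) y"
  using GDERIV_gradient[OF differentiable_ereal_at_slice[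
    OF differentiable_lagrangian[where g = g, OF assms]]]
  by simp

text \<open>
  The equality multiplier contributes the constant \<open>u v* A\<close>, so only \<open>f\<close> and the \<open>g i\<close> enter the
  Lipschitz constant of the gradient.
\<close>

lemma gradient_lagrangian:
  assumes "differentiable_ereal_at f (y, x)" "\<And>i. differentiable_ereal_at (g i) (y, x)"
  shows "gradient (\<lambda>y. lagrangian f g A B b x y u \<mu>) y =
    gradient (\<lambda>y. f (y, x)) y + u v* A + (\<Sum>i\<in>UNIV. \<mu> $ i *\<^sub>R gradient (\<lambda>y. g i (y, x)) y)"
    (is "_ = ?D")
proof (rule gradient_eqI)
  let ?r = "\<lambda>y. real_of_ereal (f (y, x)) + u \<bullet> (B *v x + A *v y - b)
      + (\<Sum>i\<in>UNIV. \<mu> $ i * real_of_ereal (g i (y, x)))"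
  note sl = assms[THEN differentiable_ereal_at_slice]
  have "\<forall>\<^sub>F w in nhds y. \<bar>f (w, x)\<bar> \<noteq> \<infinity> \<and> (\<forall>i. \<bar>g i (w, x)\<bar> \<noteq> \<infinity>)"
    using sl by (simp add: differentiable_ereal_at_def eventually_conj_iff eventually_all_finite)
  then have ev: "\<forall>\<^sub>F w in nhds y. real_of_ereal (lagrangian f g A B b x w u \<mu>) = ?r w"
    by eventually_elim (auto simp: lagrangian_eq_ereal)
  have "(?r has_derivative (\<lambda>v. v \<bullet> gradient (\<lambda>y. f (y, x)) y + u \<bullet> (A *v v)
      + (\<Sum>i\<in>UNIV. \<mu> $ i * (v \<bullet> gradient (\<lambda>y. g i (y, x)) y)))) (at y)"
    using sl[THEN GDERIV_gradient] unfolding gderiv_def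
    by (auto intro!: derivative_eq_intros
          bounded_linear.has_derivative[OF matrix_vector_mul_bounded_linear])
  then have "GDERIV ?r y :> ?D"
    unfolding gderiv_def
    by (simp add: inner_add_right inner_sum_right dot_lmul_matrix inner_commute[of _ "u v* A"])
  then show "GDERIV (\<lambda>y. real_of_ereal (lagrangian f g A B b x y u \<mu>)) y :> ?D"
    unfolding gderiv_def using ev by (rule has_derivative_transform_nhds)
qed

lemma convex_on_sum_fun:
  assumes "convex S" "\<And>i. i \<in> I \<Longrightarrow> convex_on S (h i)"
  shows "convex_on S (\<lambda>z. \<Sum>i\<in>I. h i z :: real)"
  using assms(2)
proof (induction I rule: infinite_finite_induct)
  case (insert i I)
  then show ?case by (simp add: convex_on_add)
qed (simp_all add: assms(1) convex_on_const)

text \<open>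
  For fixed \<open>\<mu> \<ge> 0\<close> the Lagrangian is jointly convex in decision and parameter. The resulting joint
  tangent inequality is what makes the slope \<open>\<nabla>\<^sub>x L\<close> of the cut valid at parameters other than \<open>x0\<close>.
\<close>

lemma lagrangian_above_tangent:
  fixes f :: "(real^'n) \<times> (real^'m) \<Rightarrow> ereal"
  assumes "convex X" "convex Y" "convex_ereal f" "\<And>i. convex_ereal (g i)"
    and df: "\<And>z. z \<in> Y \<times> X \<Longrightarrow> differentiable_ereal_at f z"
    and dg: "\<And>i z. z \<in> Y \<times> X \<Longrightarrow> differentiable_ereal_at (g i) z"
    and "\<And>i. 0 \<le> \<mu> $ i" "x0 \<in> X" "x \<in> X" "y0 \<in> Y" "y \<in> Y"
  shows "real_of_ereal (lagrangian f g A B b x0 y0 u \<mu>)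
      + gradient (\<lambda>y. lagrangian f g A B b x0 y u \<mu>) y0 \<bullet> (y - y0)
      + gradient (\<lambda>x. lagrangian f g A B b x y0 u \<mu>) x0 \<bullet> (x - x0)
    \<le> real_of_ereal (lagrangian f g A B b x y u \<mu>)"
proof -
  let ?L = "\<lambda>(y, x). lagrangian f g A B b x y u \<mu>"
  have conv: "convex (Y \<times> X)" using assms by (simp add: convex_Times)
  have fin: "\<bar>f z\<bar> \<noteq> \<infinity>" "\<bar>g i z\<bar> \<noteq> \<infinity>" if "z \<in> Y \<times> X" for z i
    using that by (intro differentiable_ereal_at_finite df dg; assumption)+
  have "convex_on (Y \<times> X) (\<lambda>z. u \<bullet> (B *v snd z + A *v fst z - b))"
  proof (rule convex_onI)
    fix t :: real and z w :: "(real^'n) \<times> (real^'m)"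
    show "u \<bullet> (B *v snd ((1 - t) *\<^sub>R z + t *\<^sub>R w) + A *v fst ((1 - t) *\<^sub>R z + t *\<^sub>R w) - b)
      \<le> (1 - t) * (u \<bullet> (B *v snd z + A *v fst z - b)) + t * (u \<bullet> (B *v snd w + A *v fst w - b))"
      by (simp add: matrix_vector_right_distrib matrix_vector_mult_scaleR inner_add_right
          inner_diff_right algebra_simps)
  qed (fact conv)
  then have cr: "convex_on (Y \<times> X) (\<lambda>z. real_of_ereal (f z) + u \<bullet> (B *v snd z + A *v fst z - b)
      + (\<Sum>i\<in>UNIV. \<mu> $ i * real_of_ereal (g i z)))" (is "convex_on _ ?r")
    using assms conv fin
    by (intro convex_on_add convex_on_sum_fun convex_on_cmul convex_on_real_of_ereal) auto
  have L: "real_of_ereal (?L z) = ?r z" if "z \<in> Y \<times> X" for z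
    using fin[OF that] by (cases z) (simp add: lagrangian_eq_ereal)
  have cL: "convex_on (Y \<times> X) (\<lambda>z. real_of_ereal (?L z))"
  proof (rule convex_onI)
    fix t :: real and z w
    assume t: "0 < t" "t < 1" and zw: "z \<in> Y \<times> X" "w \<in> Y \<times> X"
    have "(1 - t) *\<^sub>R z + t *\<^sub>R w \<in> Y \<times> X"
      using convexD[OF conv zw, of "1 - t" t] t by simp
    then show "real_of_ereal (?L ((1 - t) *\<^sub>R z + t *\<^sub>R w))
        \<le> (1 - t) * real_of_ereal (?L z) + t * real_of_ereal (?L w)"
      using convex_onD[OF cr, of t z w] t zw unfolding L[OF zw(1)] L[OF zw(2)] by (simp only: L)
  qed (fact conv)
  have dL: "differentiable_ereal_at ?L (y0, x0)"
    using assms by (intro differentiable_lagrangian) auto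
  have "real_of_ereal (?L (y0, x0)) + gradient ?L (y0, x0) \<bullet> ((y, x) - (y0, x0))
      \<le> real_of_ereal (?L (y, x))"
    using assms by (intro convex_on_above_tangent[OF cL] GDERIV_gradient dL) auto
  then show ?thesis using gradient_Pair[OF dL] by simp
qed

lemma lagrangian_le_objective:
  assumes "y \<in> feasible_set g A B b Y x" "\<And>i. 0 \<le> \<mu> $ i"
    and "\<bar>f (y, x)\<bar> \<noteq> \<infinity>" "\<And>i. \<bar>g i (y, x)\<bar> \<noteq> \<infinity>"
  shows "lagrangian f g A B b x y u \<mu> \<le> f (y, x)"
proof -
  have "\<mu> $ i * real_of_ereal (g i (y, x)) \<le> 0" for i
    using assms(1,2) unfolding feasible_set_def
    by (intro mult_nonneg_nonpos) (auto simp: real_of_ereal_pos)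
  moreover have "B *v x + A *v y - b = 0" using assms(1) by (auto simp: feasible_set_def add.commute)
  ultimately have "lagrangian f g A B b x y u \<mu> \<le> ereal (real_of_ereal (f (y, x)))"
    using assms(3,4) by (simp add: lagrangian_eq_ereal sum_nonpos)
  then show ?thesis using assms(3) by (simp add: ereal_real)
qed

text \<open>
  If the value is a real number \<open>q\<close>, the multipliers separating \<open>q\<close> from the attainable costs
  form a dual feasible pair with dual value at least \<open>q\<close>. The value \<open>\<infinity>\<close> is impossible, as the Slater
  point is feasible, and for \<open>-\<infinity>\<close> the inequality is trivial.
\<close>

lemma value_function_le_sup_dual:
  fixes g :: "'p::finite \<Rightarrow> (real^'n) \<times> (real^'m) \<Rightarrow> ereal"
  assumes "convex Y" "convex_ereal f" "\<And>i. convex_ereal (g i)"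
    and fin: "\<And>y. y \<in> Y \<Longrightarrow> \<bar>f (y, x)\<bar> \<noteq> \<infinity>" "\<And>i y. y \<in> Y \<Longrightarrow> \<bar>g i (y, x)\<bar> \<noteq> \<infinity>"
    and slater: "s \<in> rel_interior Y" "B *v x + A *v s = b" "\<And>i. g i (s, x) < 0"
  shows "value_function f g A B b Y x \<le> (SUP w\<in>dual_feasible. dual_function f g A B b Y x w)"
proof (cases "value_function f g A B b Y x")
  case (real q)
  have sY: "s \<in> Y" using slater(1) rel_interior_subset by blast
  obtain u and \<mu> :: "real^'p" where \<mu>: "\<And>i. 0 \<le> \<mu> $ i"
    and le: "\<And>y. y \<in> Y \<Longrightarrow> q \<le> real_of_ereal (f (y, x)) + u \<bullet> (A *v y - (b - B *v x))
      + (\<Sum>i\<in>UNIV. \<mu> $ i * real_of_ereal (g i (y, x)))"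
  proof (rule slater_multipliers)
    show "convex_on Y (\<lambda>y. real_of_ereal (f (y, x)))"
      "convex_on Y (\<lambda>y. real_of_ereal (g i (y, x)))" for i
      by (intro convex_on_real_of_ereal convex_ereal_slice assms(1-3) fin; assumption)+
    show "linear ((*v) A)" by simp
    show "A *v s = b - B *v x" using slater(2) by (simp add: algebra_simps)
    show "real_of_ereal (g i (s, x)) < 0" for i
      using slater(3)[of i] fin(2)[OF sY, of i] by (cases "g i (s, x)") auto
    fix y assume y: "y \<in> Y" "A *v y = b - B *v x" "\<forall>i. real_of_ereal (g i (y, x)) \<le> 0"
    have "g i (y, x) \<le> 0" for i
      using y(3) fin(2)[OF y(1), of i] by (cases "g i (y, x)") (auto dest: spec[of _ i])
    then have "y \<in> feasible_set g A B b Y x" using y unfolding feasible_set_def by simp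
    then have "ereal q \<le> f (y, x)" unfolding real[symmetric] value_function_def by (rule INF_lower)
    then show "q \<le> real_of_ereal (f (y, x))" using fin(1)[OF y(1)] by (cases "f (y, x)") auto
  qed (use assms in auto)
  have "ereal q \<le> dual_function f g A B b Y x (u, \<mu>)"
    unfolding dual_function_def prod.case
  proof (rule INF_greatest)
    fix y assume "y \<in> Y"
    then show "ereal q \<le> lagrangian f g A B b x y u \<mu>"
      using le fin by (simp add: lagrangian_eq_ereal algebra_simps)
  qed
  also have "\<dots> \<le> (SUP w\<in>dual_feasible. dual_function f g A B b Y x w)"
    by (rule SUP_upper) (use \<mu> in \<open>simp add: dual_feasible_def\<close>)
  finally show ?thesis using real by simp
next
  case PInf
  have sY: "s \<in> Y" using slater(1) rel_interior_subset by blast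
  then have "s \<in> feasible_set g A B b Y x"
    using slater by (auto simp: feasible_set_def add.commute intro: less_imp_le)
  then have "value_function f g A B b Y x \<le> f (s, x)" unfolding value_function_def by (rule INF_lower)
  then show ?thesis using PInf fin(1)[OF sY] by auto
qed simp

section \<open>Approximate dual solutions and the quality of the cut\<close>

lemma eps_dual_solution_lower_bound:
  assumes "eps_maximizer \<epsilon> dual_feasible (dual_function f g A B b Y x) (u, \<mu>)"
    and "ereal q \<le> (SUP w\<in>dual_feasible. dual_function f g A B b Y x w)" and "y \<in> Y"
  shows "ereal (q - \<epsilon>) \<le> lagrangian f g A B b x y u \<mu>"
proof -
  have "ereal q - ereal \<epsilon> \<le> (SUP w\<in>dual_feasible. dual_function f g A B b Y x w) - ereal \<epsilon>"
    using assms(2) by (rule ereal_minus_mono) simp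
  also have "\<dots> \<le> dual_function f g A B b Y x (u, \<mu>)"
    using assms(1) unfolding eps_maximizer_def by blast
  also have "\<dots> \<le> lagrangian f g A B b x y u \<mu>"
    unfolding dual_function_def prod.case using assms(3) by (rule INF_lower)
  finally show ?thesis by simp
qed

text \<open>
  In the dual function a large multiplier is penalised at a strictly feasible point: there it
  costs at least the slack \<open>MIN i. - c i\<close> per unit. So a lower bound \<open>v\<close> on the dual value caps the sum
  of the multipliers.
\<close>

lemma sum_multipliers_le:
  fixes c \<mu> :: "'p::finite \<Rightarrow> real"
  assumes "v \<le> F + (\<Sum>i\<in>UNIV. \<mu> i * c i)" "\<And>i. 0 \<le> \<mu> i" "\<And>i. c i < 0"
  shows "(\<Sum>i\<in>UNIV. \<mu> i) \<le> (F - v) / (MIN i. - c i)"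
proof -
  let ?d = "MIN i. - c i"
  have d: "?d > 0" using assms(3) by (subst Min_gr_iff) auto
  have "(\<Sum>i\<in>UNIV. \<mu> i) * ?d \<le> (\<Sum>i\<in>UNIV. \<mu> i * - c i)"
    unfolding sum_distrib_right using assms(2) by (intro sum_mono mult_left_mono) auto
  also have "\<dots> \<le> F - v" using assms(1) by (simp add: sum_negf)
  finally show ?thesis using d by (simp add: pos_le_divide_eq)
qed

theorem proposition2p8:
  fixes X :: "(real^'m) set" and Y :: "(real^'n) set"
    and A :: "real^'n^'q" and B :: "real^'m^'q" and b :: "real^'q"
    and f :: "(real^'n) \<times> (real^'m) \<Rightarrow> ereal"
    and g :: "'p::finite \<Rightarrow> (real^'n) \<times> (real^'m) \<Rightarrow> ereal"
    and M1 M2 \<epsilon> Lb :: real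
    and yS :: "real^'m \<Rightarrow> real^'n"
    and xb :: "real^'m" and yh :: "real^'n" and lh :: "real^'q" and mh :: "real^'p"
  assumes X: "X \<noteq> {}" "compact X" "convex X"
    and Y: "Y \<noteq> {}" "compact Y" "convex Y"
    and H1: "lower_semicontinuous f" "proper f" "convex_ereal f"
    and H2: "\<And>i. avoids_minf (g i)" "\<And>i. convex_ereal (g i)" "\<And>i. lower_semicontinuous (g i)"
    and H3: "\<And>z. z \<in> Y \<times> X \<Longrightarrow> differentiable_ereal_at f z"
      "M1 > 0"
      "\<And>x y1 y2. \<lbrakk>x \<in> X; y1 \<in> Y; y2 \<in> Y\<rbrakk> \<Longrightarrow>
         norm (gradient (\<lambda>y. f (y, x)) y2 - gradient (\<lambda>y. f (y, x)) y1) \<le> M1 * norm (y2 - y1)"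
    and H4: "\<And>x. x \<in> X \<Longrightarrow>
       yS x \<in> rel_interior Y \<and> B *v x + A *v yS x = b \<and> (\<forall>i. g i (yS x, x) < 0)"
    and H5: "\<And>i z. z \<in> Y \<times> X \<Longrightarrow> differentiable_ereal_at (g i) z"
      "M2 > 0"
      "\<And>i x y1 y2. \<lbrakk>x \<in> X; y1 \<in> Y; y2 \<in> Y\<rbrakk> \<Longrightarrow>
         norm (gradient (\<lambda>y. g i (y, x)) y2 - gradient (\<lambda>y. g i (y, x)) y1) \<le> M2 * norm (y2 - y1)"
    and xb: "xb \<in> X"
    and eps: "\<epsilon> \<ge> 0"
    and primal: "eps_minimizer \<epsilon> (feasible_set g A B b Y xb) (\<lambda>y. f (y, xb)) yh"
    and dual: "eps_maximizer \<epsilon> dual_feasible (dual_function f g A B b Y xb) (lh, mh)"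
    and Lb: "ereal Lb \<le> value_function f g A B b Y xb"
  shows "let Q = value_function f g A B b Y;
             L = (\<lambda>x. lagrangian f g A B b x yh lh mh);
             l2 = ell2 f g A B b Y yh xb lh mh;
             C = (\<lambda>x. real_of_ereal (L xb) - l2 + gradient L xb \<bullet> (x - xb));
             U = (real_of_ereal (f (yS xb, xb)) - Lb + \<epsilon>)
                   / (MIN i. - real_of_ereal (g i (yS xb, xb)));
             M3 = M1 + U * M2;
             D = diameter Y;
             \<epsilon>0 = (if l2 \<le> M3 * D\<^sup>2 then \<epsilon> + l2 - l2\<^sup>2 / (2 * M3 * D\<^sup>2) else \<epsilon> + l2 / 2)
         in is_cut X Q C \<and> Q xb - ereal (C xb) \<le> ereal \<epsilon>0"
proof -
  let ?Q = "value_function f g A B b Y"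
  let ?L = "\<lambda>x. lagrangian f g A B b x yh lh mh"
  let ?l2 = "ell2 f g A B b Y yh xb lh mh"
  let ?gx = "gradient ?L xb"
  let ?C = "\<lambda>x. real_of_ereal (?L xb) - ?l2 + ?gx \<bullet> (x - xb)"
  let ?c = "\<lambda>i. real_of_ereal (g i (yS xb, xb))"
  let ?U = "(real_of_ereal (f (yS xb, xb)) - Lb + \<epsilon>) / (MIN i. - ?c i)"
  let ?M3 = "M1 + ?U * M2"
  let ?D = "diameter Y"
  define \<phi> where "\<phi> y = real_of_ereal (lagrangian f g A B b xb y lh mh)" for y
  define d where "d y = gradient (\<lambda>y. lagrangian f g A B b xb y lh mh) y" for y
  have yh: "yh \<in> feasible_set g A B b Y xb" and yhY: "yh \<in> Y"
    using primal unfolding eps_minimizer_def feasible_set_def by auto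
  have mh: "0 \<le> mh $ i" for i
    using dual unfolding eps_maximizer_def dual_feasible_def by auto
  have fin: "\<bar>f (y, x)\<bar> \<noteq> \<infinity>" "\<bar>g i (y, x)\<bar> \<noteq> \<infinity>" if "y \<in> Y" "x \<in> X" for i y x
    using that by (auto intro!: differentiable_ereal_at_finite H3(1) H5(1))
  have finL: "\<bar>lagrangian f g A B b x y lh mh\<bar> \<noteq> \<infinity>" if "y \<in> Y" "x \<in> X" for y x
    using that fin by (simp add: lagrangian_eq_ereal)
  have yS: "yS xb \<in> rel_interior Y" "B *v xb + A *v yS xb = b" "g i (yS xb, xb) < 0" for i
    using H4[OF xb] by auto
  have ySY: "yS xb \<in> Y" using yS(1) rel_interior_subset by blast

  \<comment> \<open>\<open>Y\<close> is compact, so the supremum defining \<open>\<ell>\<^sub>2\<close> is finite and dominates each of its terms\<close>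
  have l2: "d yh \<bullet> (yh - y) \<le> ?l2" if "y \<in> Y" for y
  proof -
    have "bdd_above ((\<lambda>y. d yh \<bullet> (yh - y)) ` Y)"
      by (intro bounded_imp_bdd_above compact_imp_bounded compact_continuous_image
          continuous_intros Y(2))
    then show ?thesis unfolding ell2_def d_def[symmetric] using that by (intro cSUP_upper)
  qed
  \<comment> \<open>On the feasible set for \<open>x\<close> the objective dominates the Lagrangian, which dominates its joint
    tangent plane at \<open>(yh, xb)\<close>; the \<open>y\<close>-part of that plane is at least \<open>-\<ell>\<^sub>2\<close>.\<close>
  have "is_cut X ?Q ?C"
    unfolding is_cut_def
  proof (intro conjI ballI)
    have "\<forall>x. ?C x = ?gx \<bullet> x + (real_of_ereal (?L xb) - ?l2 - ?gx \<bullet> xb)"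
      by (simp add: inner_diff_right)
    then show "\<exists>a c. \<forall>x. ?C x = a \<bullet> x + c" by blast
  next
    fix x assume x: "x \<in> X"
    show "ereal (?C x) \<le> ?Q x"
      unfolding value_function_def
    proof (rule INF_greatest)
      fix y assume y: "y \<in> feasible_set g A B b Y x"
      then have yY: "y \<in> Y" unfolding feasible_set_def by simp
      have "real_of_ereal (?L xb) + d yh \<bullet> (y - yh) + ?gx \<bullet> (x - xb)
          \<le> real_of_ereal (lagrangian f g A B b x y lh mh)"
        unfolding d_def
        by (rule lagrangian_above_tangent[OF X(3) Y(3) H1(3) H2(2) H3(1) H5(1) mh xb x yhY yY])
      moreover have "d yh \<bullet> (y - yh) = - (d yh \<bullet> (yh - y))" by (simp add: inner_diff_right)
      ultimately have "?C x \<le> real_of_ereal (lagrangian f g A B b x y lh mh)"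
        using l2[OF yY] by linarith
      then have "ereal (?C x) \<le> lagrangian f g A B b x y lh mh"
        using finL[OF yY x] by (cases "lagrangian f g A B b x y lh mh") auto
      also have "\<dots> \<le> f (y, x)"
        using y mh fin[OF yY x] by (intro lagrangian_le_objective) auto
      finally show "ereal (?C x) \<le> f (y, x)" .
    qed
  qed

  moreover have "?Q xb - ereal (?C xb) \<le> ereal
      (if ?l2 \<le> ?M3 * ?D\<^sup>2 then \<epsilon> + ?l2 - ?l2\<^sup>2 / (2 * ?M3 * ?D\<^sup>2) else \<epsilon> + ?l2 / 2)"
  proof -
    have "yS xb \<in> feasible_set g A B b Y xb"
      using yS ySY by (auto simp: feasible_set_def add.commute intro: less_imp_le)
    then have "?Q xb \<le> f (yS xb, xb)" unfolding value_function_def by (rule INF_lower)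
    then obtain q where q: "?Q xb = ereal q"
      using Lb fin(1)[OF ySY xb] by (cases "?Q xb") auto
    have Lbq: "Lb \<le> q" using Lb q by simp
    \<comment> \<open>strong duality turns \<open>\<epsilon>\<close>-optimality of the multipliers into a bound on the Lagrangian\<close>
    have dual_bound: "q - \<epsilon> \<le> \<phi> y" if y: "y \<in> Y" for y
    proof -
      have "ereal q \<le> (SUP w\<in>dual_feasible. dual_function f g A B b Y xb w)"
        unfolding q[symmetric] using Y H1 H2 fin xb yS
        by (intro value_function_le_sup_dual[where s = "yS xb"]) auto
      from eps_dual_solution_lower_bound[OF dual this y]
      show ?thesis unfolding \<phi>_def using finL[OF y xb]
        by (cases "lagrangian f g A B b xb y lh mh") auto
    qed
    have cneg: "?c i < 0" for i
      using yS(3)[of i] fin(2)[OF ySY xb, of i] by (cases "g i (yS xb, xb)") auto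
    have "B *v xb + A *v yS xb - b = 0" using yS(2) by simp
    then have "\<phi> (yS xb) = real_of_ereal (f (yS xb, xb)) + (\<Sum>i\<in>UNIV. mh $ i * ?c i)"
      unfolding \<phi>_def using fin[OF ySY xb] by (simp add: lagrangian_eq_ereal)
    then have "Lb - \<epsilon> \<le> real_of_ereal (f (yS xb, xb)) + (\<Sum>i\<in>UNIV. mh $ i * ?c i)"
      using dual_bound[OF ySY] Lbq by simp
    from sum_multipliers_le[OF this mh cneg]
    have U: "(\<Sum>i\<in>UNIV. mh $ i) \<le> ?U" by (simp add: algebra_simps)
    have U0: "0 \<le> ?U" using U mh sum_nonneg[of UNIV "\<lambda>i. mh $ i"] by force
    then have M3: "0 < ?M3" using H3(2) H5(2) mult_nonneg_nonneg[of ?U M2] by linarith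

    \<comment> \<open>the Lipschitz constant is \<open>M1 + (\<Sum>i. mh $ i) * M2\<close>, and \<open>?U\<close> bounds the sum of the multipliers\<close>
    have lip: "norm (d z - d y) \<le> ?M3 * norm (z - y)" if yz: "y \<in> Y" "z \<in> Y" for y z
    proof -
      let ?df = "\<lambda>y. gradient (\<lambda>y. f (y, xb)) y" and ?dg = "\<lambda>i y. gradient (\<lambda>y. g i (y, xb)) y"
      have d: "d y = ?df y + lh v* A + (\<Sum>i\<in>UNIV. mh $ i *\<^sub>R ?dg i y)" if "y \<in> Y" for y
        unfolding d_def using that xb H3(1) H5(1) by (intro gradient_lagrangian) auto
      have "d z - d y = (?df z - ?df y) + (\<Sum>i\<in>UNIV. mh $ i *\<^sub>R (?dg i z - ?dg i y))"
        by (simp add: d yz scaleR_diff_right sum_subtractf)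
      also have "norm \<dots> \<le> norm (?df z - ?df y) + (\<Sum>i\<in>UNIV. norm (mh $ i *\<^sub>R (?dg i z - ?dg i y)))"
        by (intro norm_triangle_mono norm_sum order_refl)
      also have "\<dots> \<le> M1 * norm (z - y) + (\<Sum>i\<in>UNIV. mh $ i * (M2 * norm (z - y)))"
        using H3(3)[OF xb yz] H5(3)[OF xb yz] mh
        by (intro add_mono sum_mono) (auto intro: mult_left_mono)
      also have "\<dots> = M1 * norm (z - y) + (\<Sum>i\<in>UNIV. mh $ i) * (M2 * norm (z - y))"
        by (simp add: sum_distrib_right)
      also have "\<dots> \<le> M1 * norm (z - y) + ?U * (M2 * norm (z - y))"
        using U H5(2) by (intro add_left_mono mult_right_mono) auto
      also have "\<dots> = ?M3 * norm (z - y)" by (simp add: distrib_right mult.assoc)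
      finally show ?thesis .
    qed
    have der: "GDERIV \<phi> y :> d y" if "y \<in> Y" for y
      unfolding \<phi>_def[abs_def] d_def using that xb H3(1) H5(1) by (intro GDERIV_lagrangian) auto
    have "\<exists>w\<in>Y. \<phi> w \<le> \<phi> yh - (if ?l2 \<le> ?M3 * ?D\<^sup>2 then ?l2\<^sup>2 / (2 * ?M3 * ?D\<^sup>2) else ?l2 / 2)"
      unfolding ell2_def d_def[symmetric]
      using frank_wolfe_decrease[OF Y(3,2) der lip yhY M3] .
    \<comment> \<open>\<open>q - \<epsilon>\<close> is below the Lagrangian on all of \<open>Y\<close>, in particular at the point reached by the step\<close>
    then have "q - \<epsilon> \<le> \<phi> yh
        - (if ?l2 \<le> ?M3 * ?D\<^sup>2 then ?l2\<^sup>2 / (2 * ?M3 * ?D\<^sup>2) else ?l2 / 2)"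
      using dual_bound order_trans by blast
    then show ?thesis unfolding q \<phi>_def by (auto split: if_splits)
  qed
  ultimately show ?thesis unfolding Let_def by (rule conjI)
qed

end
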